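(* Let $\mathcal{X}$ be $[0,1]^d$ or $\mathbb{R}^d$, let $p_0$ be a probability density on $\mathcal{X}$, let $0<C<\infty$, and suppose $\|p_0\|_\infty<\infty$ and $\|p_0\|_{\mathrm{Lip}}<C$. Fix $\delta\in[0,1/2)$. For $\lambda\geq 0$ let $q_\lambda$ be the optimal solution of $$\min_{q\in\mathcal{Q}_{\delta,C}}\ \max_{\{D_t\}\subset\mathcal{U}_0}\ \mathbb{E}_{t\sim\pi}\big[F_{p_t}(q_t,D_t;\lambda)\big].$$ Then $\|q_\lambda-p_0\|_\infty=O\big(\lambda^{\frac{1}{d+3}}\big)$ as $\lambda\searrow 0$.
   Context: All densities are with respect to Lebesgue measure $\mu$ and are assumed strictly positive on their domain. $\|f\|_\infty$ is the (essential) supremum of $|f|$; $\|f\|_{\mathrm{Lip}}=\sup_{\boldsymbol{x}\ne\boldsymbol{y}}|f(\boldsymbol{x})-f(\boldsymbol{y})|/\|\boldsymbol{x}-\boldsymbol{y}\|$ with the Euclidean norm. For $\delta\in[0,1/2)$, $\mathcal{U}_\delta=\{f\in L^\infty:\delta<\inf f,\ \sup f<1-\delta\}$ (essential inf/sup), and $$\mathcal{Q}_{\delta,C}=\Big\{q\in L^1\cap L^\infty : \tfrac{p_0}{p_0+q}\in\mathcal{U}_\delta,\ \|q\|_{\mathrm{Lip}}\le C,\ \int q\,d\mu=1\Big\}.$$ Let $\pi$ be a probability density on $[0,T]$ with $\pi(t)>0$, and $s_t\in(0,1]$, $t\in[0,T]$, a scaling function with $s_0=1$. For a density $q$ on $\mathcal{X}$,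 $q_t(\boldsymbol{y})=q(\boldsymbol{y}/s_t)/s_t^d$ is the density on $s_t\mathcal{X}$ of $s_t\boldsymbol{x}$, $\boldsymbol{x}\sim q$; likewise $p_t(\boldsymbol{y})=p_0(\boldsymbol{y}/s_t)/s_t^d$. The discriminator $D_t$ is a function on $s_t\mathcal{X}$ belonging to $\mathcal{U}_0$. For densities $p,q$ and a discriminator $D$ with values in $(0,1)$, $$F_{p}(q,D;\lambda)=\mathbb{E}_p[\log D]+\mathbb{E}_q[\log(1-D)]-\lambda\,\mathbb{V}_p[D],$$ where $\mathbb{V}_p$ denotes the variance. The constant in $O(\cdot)$ does not depend on $\lambda$ (it may depend on $p_0,d,\delta,C$). *)

theory Defs
  imports "HOL-Probability.Probability"
begin

text \<open>
  Functions on a domain \<open>S\<close> are total functions of which only the values on \<open>S\<close> matter;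
  all integrals and almost-everywhere statements are with respect to \<open>lebesgue_on S\<close>.
\<close>

definition ess_sup_on :: "'a::euclidean_space set \<Rightarrow> ('a \<Rightarrow> real) \<Rightarrow> ereal" where
  "ess_sup_on S f = esssup (lebesgue_on S) (\<lambda>x. ereal (f x))"

definition ess_inf_on :: "'a::euclidean_space set \<Rightarrow> ('a \<Rightarrow> real) \<Rightarrow> ereal" where
  "ess_inf_on S f = - esssup (lebesgue_on S) (\<lambda>x. - ereal (f x))"

definition Linf_norm_on :: "'a::euclidean_space set \<Rightarrow> ('a \<Rightarrow> real) \<Rightarrow> ereal" where
  "Linf_norm_on S f = esssup (lebesgue_on S) (\<lambda>x. ereal \<bar>f x\<bar>)"

definition Linf_on :: "'a::euclidean_space set \<Rightarrow> ('a \<Rightarrow> real) set" where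
  "Linf_on S = {f \<in> borel_measurable (lebesgue_on S). Linf_norm_on S f < \<infinity>}"

definition Lip_norm_on :: "'a::euclidean_space set \<Rightarrow> ('a \<Rightarrow> real) \<Rightarrow> ennreal" where
  "Lip_norm_on S f =
     (SUP (x, y) \<in> {(x, y). x \<in> S \<and> y \<in> S \<and> x \<noteq> y}. ennreal (\<bar>f x - f y\<bar> / norm (x - y)))"

definition prob_density_on :: "'a::euclidean_space set \<Rightarrow> ('a \<Rightarrow> real) \<Rightarrow> bool" where
  "prob_density_on S p \<longleftrightarrow>
     integrable (lebesgue_on S) p \<and> (\<forall>x\<in>S. 0 < p x) \<and> (LINT x|lebesgue_on S. p x) = 1"

definition density_on :: "'a::euclidean_space set \<Rightarrow> ('a \<Rightarrow> real) \<Rightarrow> 'a measure" where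
  "density_on S p = density (lebesgue_on S) (\<lambda>x. ennreal (p x))"

definition U_class :: "real \<Rightarrow> 'a::euclidean_space set \<Rightarrow> ('a \<Rightarrow> real) set" where
  "U_class \<delta> S = {f \<in> Linf_on S. ereal \<delta> < ess_inf_on S f \<and> ess_sup_on S f < ereal (1 - \<delta>)}"

text \<open>
  No positivity of \<open>q\<close> is required separately: as \<open>p0 > 0\<close> on \<open>X\<close> and \<open>\<delta> \<ge> 0\<close>, the
  condition on \<open>p0 / (p0 + q)\<close> forces \<open>q > 0\<close> almost everywhere (points where
  \<open>p0 + q = 0\<close>, at which the quotient is \<open>0\<close>, are thereby confined to a null set).
\<close>

definition Q_class ::
    "'a::euclidean_space set \<Rightarrow> ('a \<Rightarrow> real) \<Rightarrow> real \<Rightarrow> real \<Rightarrow> ('a \<Rightarrow> real) set" where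
  "Q_class X p0 \<delta> C =
     {q. integrable (lebesgue_on X) q \<and> q \<in> Linf_on X \<and>
         (\<lambda>x. p0 x / (p0 x + q x)) \<in> U_class \<delta> X \<and>
         Lip_norm_on X q \<le> ennreal C \<and> (LINT x|lebesgue_on X. q x) = 1}"

definition scaled_density :: "real \<Rightarrow> (real ^ 'n \<Rightarrow> real) \<Rightarrow> real ^ 'n \<Rightarrow> real" where
  "scaled_density c q y = q (y /\<^sub>R c) / c ^ CARD('n)"

definition F_obj ::
    "'a::euclidean_space set \<Rightarrow> ('a \<Rightarrow> real) \<Rightarrow> ('a \<Rightarrow> real) \<Rightarrow> ('a \<Rightarrow> real) \<Rightarrow> real \<Rightarrow> real" where
  "F_obj S p q D lam =
     prob_space.expectation (density_on S p) (\<lambda>y. ln (D y))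
     + prob_space.expectation (density_on S q) (\<lambda>y. ln (1 - D y))
     - lam * prob_space.variance (density_on S p) D"

definition F_at ::
    "(real ^ 'n) set \<Rightarrow> (real ^ 'n \<Rightarrow> real) \<Rightarrow> (real \<Rightarrow> real) \<Rightarrow> (real ^ 'n \<Rightarrow> real)
     \<Rightarrow> (real \<Rightarrow> real ^ 'n \<Rightarrow> real) \<Rightarrow> real \<Rightarrow> real \<Rightarrow> real" where
  "F_at X p0 s q D lam t =
     F_obj ((\<lambda>x. s t *\<^sub>R x) ` X) (scaled_density (s t) p0) (scaled_density (s t) q) (D t) lam"

text \<open>
  The bounds of \<open>D t\<close> away from \<open>0\<close> and \<open>1\<close> need not be uniform in \<open>t\<close>, so the expectation over
  \<open>t\<close> may be \<open>-\<infinity>\<close>; the Bochner integral would return \<open>0\<close> there, which exceeds every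
  finite value of the objective.  Hence the integral of the positive part minus that of the
  negative part, in \<open>ereal\<close>.  The positive part vanishes for the objective at hand
  (\<open>ln (D t)\<close> and \<open>ln (1 - D t)\<close> are negative), so \<open>\<infinity> - \<infinity>\<close> does not occur.
\<close>

definition ext_expectation :: "'a measure \<Rightarrow> ('a \<Rightarrow> real) \<Rightarrow> ereal" where
  "ext_expectation M f =
     enn2ereal (\<integral>\<^sup>+ x. ennreal (f x) \<partial>M) - enn2ereal (\<integral>\<^sup>+ x. ennreal (- f x) \<partial>M)"

text \<open>
  Admissible discriminator families; the measurability clause says that the expectation over
  \<open>t\<close> is meaningful.
\<close>

definition discriminator_families ::
    "(real ^ 'n) set \<Rightarrow> (real ^ 'n \<Rightarrow> real) \<Rightarrow> real \<Rightarrow> (real \<Rightarrow> real) \<Rightarrow> (real ^ 'n \<Rightarrow> real) \<Rightarrow> real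
     \<Rightarrow> (real \<Rightarrow> real ^ 'n \<Rightarrow> real) set" where
  "discriminator_families X p0 T s q lam =
     {D. (\<forall>t\<in>{0..T}. D t \<in> U_class 0 ((\<lambda>x. s t *\<^sub>R x) ` X)) \<and>
         F_at X p0 s q D lam \<in> borel_measurable (lebesgue_on {0..T})}"

definition max_value ::
    "(real ^ 'n) set \<Rightarrow> (real ^ 'n \<Rightarrow> real) \<Rightarrow> real \<Rightarrow> (real \<Rightarrow> real) \<Rightarrow> (real \<Rightarrow> real) \<Rightarrow> real
     \<Rightarrow> (real ^ 'n \<Rightarrow> real) \<Rightarrow> ereal" where
  "max_value X p0 T \<pi> s lam q =
     (SUP D \<in> discriminator_families X p0 T s q lam.
        ext_expectation (density_on {0..T} \<pi>) (F_at X p0 s q D lam))"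

definition optimal_solution ::
    "(real ^ 'n) set \<Rightarrow> (real ^ 'n \<Rightarrow> real) \<Rightarrow> real \<Rightarrow> real \<Rightarrow> real \<Rightarrow> (real \<Rightarrow> real) \<Rightarrow> (real \<Rightarrow> real)
     \<Rightarrow> real \<Rightarrow> (real ^ 'n \<Rightarrow> real) \<Rightarrow> bool" where
  "optimal_solution X p0 \<delta> C T \<pi> s lam q \<longleftrightarrow>
     is_arg_min (max_value X p0 T \<pi> s lam) (\<lambda>q. q \<in> Q_class X p0 \<delta> C) q"

end

theory Submission
  imports Defs
begin

text \<open>
  The optimal discriminator \<open>D = p0 / (p0 + q)\<close> turns the adversarial objective into
  \<open>2 JSD(p0, q) - ln 4 - \<lambda> Var(D)\<close>, while the value at \<open>q = p0\<close> is at most \<open>- ln 4\<close>; hence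
  optimality gives \<open>2 JSD(p0, q) \<le> \<lambda> Var(D)\<close>.  Both sides are comparable to the same integral:
  \<open>Var(D) \<le> \<integral> p0 (D - 1/2)\<^sup>2\<close>, whereas a Pinsker-type inequality gives
  \<open>2 JSD(p0, q) \<ge> (2/9) \<integral> p0 (D - 1/2)\<^sup>2\<close>.  So as soon as \<open>\<lambda> < 2/9\<close> the integral vanishes and
  \<open>q = p0\<close> almost everywhere; the claimed rate holds with constant \<open>0\<close>.  The time marginals are
  push-forwards under \<open>x \<mapsto> s t x\<close>, so every \<open>t\<close> contributes the same objective.
\<close>

section \<open>Scaling maps: measurability, Lebesgue measure and push-forward of densities\<close>

lemma measurable_lebesgue_on_scaleR:
  fixes X :: "'a::euclidean_space set"
  shows "(*\<^sub>R) c \<in> lebesgue_on X \<rightarrow>\<^sub>M lebesgue_on ((\<lambda>x. c *\<^sub>R x) ` X)"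
  by (rule measurable_restrict_space3) auto

lemma measurable_lebesgue_on_divideR:
  fixes X :: "'a::euclidean_space set"
  assumes "0 < c"
  shows "(\<lambda>y. y /\<^sub>R c) \<in> lebesgue_on ((\<lambda>x. c *\<^sub>R x) ` X) \<rightarrow>\<^sub>M lebesgue_on X"
  using assms by (intro measurable_restrict_space3) auto

lemma sets_lebesgue_scaleR_image:
  fixes X :: "'a::euclidean_space set"
  assumes "X \<in> sets lebesgue" "c \<noteq> 0"
  shows "(\<lambda>x. c *\<^sub>R x) ` X \<in> sets lebesgue"
proof -
  have "(\<lambda>x. c *\<^sub>R x) ` X = (*\<^sub>R) (inverse c) -` X \<inter> space lebesgue"
    using assms(2) by (force simp: image_iff)
  also have "\<dots> \<in> sets lebesgue"
    using assms(1) by (intro measurable_sets[OF lebesgue_measurable_scaling])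
  finally show ?thesis .
qed

text \<open>The preimage of a set under multiplication by \<open>c\<close> is its dilation by
  \<open>inverse c\<close>, whose volume shrinks by \<open>1 / c ^ DIM('a)\<close>. This factor is
  the normalisation built into \<open>scaled_density\<close>.\<close>

lemma distr_lebesgue_on_scaleR:
  fixes X :: "'a::euclidean_space set"
  assumes X: "X \<in> sets lebesgue" and c: "0 < c"
  shows "distr (lebesgue_on X) (lebesgue_on ((\<lambda>x. c *\<^sub>R x) ` X)) ((*\<^sub>R) c)
       = density (lebesgue_on ((\<lambda>x. c *\<^sub>R x) ` X)) (\<lambda>_. ennreal (1 / c ^ DIM('a)))"
    (is "distr _ ?N _ = _")
proof (rule measure_eqI)
  note Y = sets_lebesgue_scaleR_image[OF X, of c]
  fix A assume "A \<in> sets (distr (lebesgue_on X) ?N ((*\<^sub>R) c))"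
  then have A: "A \<in> sets ?N" by simp
  then have A': "A \<in> sets lebesgue" "A \<subseteq> (\<lambda>x. c *\<^sub>R x) ` X"
    using Y c by (auto simp: sets_restrict_space_iff)
  \<comment> \<open>The summand \<open>0\<close> brings the preimage into the form that
    \<open>emeasure_lebesgue_affine\<close> expects.\<close>
  have pre: "(*\<^sub>R) c -` A \<inter> X = (\<lambda>x. inverse c *\<^sub>R x + 0) ` A"
    using c A'(2) by (force simp: image_iff)
  have "emeasure (distr (lebesgue_on X) ?N ((*\<^sub>R) c)) A = emeasure (lebesgue_on X) ((*\<^sub>R) c -` A \<inter> X)"
    using A by (subst emeasure_distr[OF measurable_lebesgue_on_scaleR]) auto
  also have "\<dots> = emeasure lebesgue ((*\<^sub>R) c -` A \<inter> X)"
    using X by (intro emeasure_restrict_space) auto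
  also have "\<dots> = \<bar>inverse c\<bar> ^ DIM('a) * emeasure lebesgue A"
    unfolding pre using emeasure_lebesgue_affine[of "inverse c" 0 A] by (simp add: add.commute)
  also have "\<dots> = ennreal (1 / c ^ DIM('a)) * emeasure ?N A"
    using A' Y c by (simp add: emeasure_restrict_space power_inverse inverse_eq_divide power_divide)
  also have "\<dots> = emeasure (density ?N (\<lambda>_. ennreal (1 / c ^ DIM('a)))) A"
    using A by (simp add: emeasure_density_const)
  finally show "emeasure (distr (lebesgue_on X) ?N ((*\<^sub>R) c)) A
      = emeasure (density ?N (\<lambda>_. ennreal (1 / c ^ DIM('a)))) A" .
qed simp

text \<open>Justifies the formula of \<open>scaled_density\<close>: it is the law of
  \<open>c\<close> times a point drawn from \<open>q\<close>. The Jacobian comes from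
  \<open>distr_lebesgue_on_scaleR\<close>.\<close>

lemma density_on_scaled_density:
  fixes X :: "(real ^ 'n) set"
  assumes X: "X \<in> sets lebesgue" and c: "0 < c"
    and q: "q \<in> borel_measurable (lebesgue_on X)"
  shows "density_on ((\<lambda>x. c *\<^sub>R x) ` X) (scaled_density c q)
       = distr (density_on X q) (lebesgue_on ((\<lambda>x. c *\<^sub>R x) ` X)) ((*\<^sub>R) c)"
proof -
  let ?N = "lebesgue_on ((\<lambda>x. c *\<^sub>R x) ` X)"
  have qc: "(\<lambda>y. ennreal (q (y /\<^sub>R c))) \<in> borel_measurable ?N"
    using measurable_compose[OF measurable_lebesgue_on_divideR[OF c] q] by measurable
  \<comment> \<open>Writing \<open>q x\<close> as a function of \<open>c *\<^sub>R x\<close> makes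
    the density factor through the map, as \<open>density_distr\<close> requires.\<close>
  have "distr (density_on X q) ?N ((*\<^sub>R) c)
      = distr (density (lebesgue_on X) (\<lambda>x. ennreal (q ((c *\<^sub>R x) /\<^sub>R c)))) ?N ((*\<^sub>R) c)"
    using c by (simp add: density_on_def)
  also have "\<dots> = density (distr (lebesgue_on X) ?N ((*\<^sub>R) c)) (\<lambda>y. ennreal (q (y /\<^sub>R c)))"
    by (rule density_distr[OF qc measurable_lebesgue_on_scaleR, symmetric])
  also have "\<dots> = density ?N (\<lambda>y. ennreal (1 / c ^ CARD('n)) * ennreal (q (y /\<^sub>R c)))"
    using qc by (simp add: distr_lebesgue_on_scaleR[OF X c] density_density_eq)
  also have "(\<lambda>y. ennreal (1 / c ^ CARD('n)) * ennreal (q (y /\<^sub>R c)))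
           = (\<lambda>y. ennreal (scaled_density c q y))"
    using c by (simp add: scaled_density_def fun_eq_iff ennreal_mult'[symmetric])
  finally show ?thesis by (simp add: density_on_def)
qed

section \<open>The class \<open>U_class 0\<close>, and invariance of the objective under
  scaling\<close>

text \<open>A strict inequality between an essential supremum and its bound leaves room for a real
  number in between, hence a uniform margin \<epsilon>. This margin later makes
  \<open>ln (D x)\<close> and \<open>ln (1 - D x)\<close> bounded.\<close>

lemma U_class_0_iff:
  "f \<in> U_class 0 S \<longleftrightarrow> f \<in> borel_measurable (lebesgue_on S) \<and>
     (\<exists>\<epsilon>>0. AE x in lebesgue_on S. \<epsilon> \<le> f x \<and> f x \<le> 1 - \<epsilon>)"
proof (intro iffI conjI; (elim conjE exE)?)
  assume f: "f \<in> U_class 0 S"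
  then show "f \<in> borel_measurable (lebesgue_on S)"
    by (simp add: U_class_def Linf_on_def)
  have lo: "esssup (lebesgue_on S) (\<lambda>x. - ereal (f x)) < 0"
    and hi: "esssup (lebesgue_on S) (\<lambda>x. ereal (f x)) < 1"
    using f by (auto simp: U_class_def ess_inf_on_def ess_sup_on_def ereal_less_uminus_reorder
        simp flip: zero_ereal_def one_ereal_def)
  \<comment> \<open>Almost everywhere \<open>f\<close> lies between \<open>- a\<close> and
    \<open>b\<close>, so the smaller of \<open>- a\<close> and \<open>1 - b\<close> serves as margin
    on both sides.\<close>
  obtain a where a: "esssup (lebesgue_on S) (\<lambda>x. - ereal (f x)) < ereal a" "a < 0"
    using ereal_dense2[OF lo] by (metis ereal_less(2) less_ereal.simps(1) zero_ereal_def)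
  obtain b where b: "esssup (lebesgue_on S) (\<lambda>x. ereal (f x)) < ereal b" "b < 1"
    using ereal_dense2[OF hi] by (metis less_ereal.simps(1) one_ereal_def)
  have "AE x in lebesgue_on S. min (- a) (1 - b) \<le> f x \<and> f x \<le> 1 - min (- a) (1 - b)"
    using esssup_AE[of "\<lambda>x. - ereal (f x)" "lebesgue_on S"]
      esssup_AE[of "\<lambda>x. ereal (f x)" "lebesgue_on S"]
  proof eventually_elim
    case (elim x)
    from elim(1) a(1) have "- ereal (f x) < ereal a" by order
    moreover from elim(2) b(1) have "ereal (f x) < ereal b" by order
    ultimately show ?case by auto
  qed
  then show "\<exists>\<epsilon>>0. AE x in lebesgue_on S. \<epsilon> \<le> f x \<and> f x \<le> 1 - \<epsilon>"
    using a(2) b(2) by (intro exI[of _ "min (- a) (1 - b)"]) auto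
next
  fix \<epsilon> :: real
  assume [measurable]: "f \<in> borel_measurable (lebesgue_on S)" and "0 < \<epsilon>"
    and ae: "AE x in lebesgue_on S. \<epsilon> \<le> f x \<and> f x \<le> 1 - \<epsilon>"
  have "esssup (lebesgue_on S) (\<lambda>x. ereal \<bar>f x\<bar>) \<le> ereal 1"
    using ae \<open>0 < \<epsilon>\<close> by (intro esssup_I) auto
  moreover have "esssup (lebesgue_on S) (\<lambda>x. - ereal (f x)) \<le> ereal (- \<epsilon>)"
    using ae by (intro esssup_I) auto
  moreover have "esssup (lebesgue_on S) (\<lambda>x. ereal (f x)) \<le> ereal (1 - \<epsilon>)"
    using ae by (intro esssup_I) auto
  moreover have "ereal (- \<epsilon>) < 0" "ereal (1 - \<epsilon>) < 1"
    using \<open>0 < \<epsilon>\<close> by (auto simp: zero_ereal_def one_ereal_def)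
  ultimately have "esssup (lebesgue_on S) (\<lambda>x. ereal \<bar>f x\<bar>) < \<infinity>"
    "esssup (lebesgue_on S) (\<lambda>x. - ereal (f x)) < 0"
    "esssup (lebesgue_on S) (\<lambda>x. ereal (f x)) < 1"
    by (auto intro: order.strict_trans1 simp del: uminus_ereal.simps)
  then show "f \<in> U_class 0 S"
    by (auto simp: U_class_def Linf_on_def Linf_norm_on_def ess_inf_on_def ess_sup_on_def
        ereal_less_uminus_reorder simp flip: zero_ereal_def one_ereal_def)
qed

lemma U_class_mono: "\<delta> \<le> \<delta>' \<Longrightarrow> U_class \<delta>' S \<subseteq> U_class \<delta> S"
  by (auto simp: U_class_def elim: le_less_trans[rotated] less_le_trans)

text \<open>The push-forward of Lebesgue measure is a positive multiple of Lebesgue measure, so both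
  have the same null sets. Since \<open>P\<close> may fail to be measurable, the transfer is done
  for a measurable null set \<open>Z\<close> covering its exceptions.\<close>

lemma AE_lebesgue_on_divideR:
  fixes X :: "'a::euclidean_space set"
  assumes X: "X \<in> sets lebesgue" and c: "0 < c" and P: "AE x in lebesgue_on X. P x"
  shows "AE y in lebesgue_on ((\<lambda>x. c *\<^sub>R x) ` X). P (y /\<^sub>R c)"
proof -
  let ?N = "lebesgue_on ((\<lambda>x. c *\<^sub>R x) ` X)"
  from P obtain Z where Z: "Z \<in> null_sets (lebesgue_on X)" "{x \<in> space (lebesgue_on X). \<not> P x} \<subseteq> Z"
    by (auto simp: eventually_ae_filter)
  have "AE x in lebesgue_on X. (c *\<^sub>R x) /\<^sub>R c \<notin> Z"
    using c AE_not_in[OF Z(1)] by simp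
  then have "AE y in distr (lebesgue_on X) ?N ((*\<^sub>R) c). y /\<^sub>R c \<notin> Z"
  proof (subst AE_distr_iff[OF measurable_lebesgue_on_scaleR])
    have "(\<lambda>y. y /\<^sub>R c) -` (space (lebesgue_on X) - Z) \<inter> space ?N \<in> sets ?N"
      using Z(1) c by (intro measurable_sets[OF measurable_lebesgue_on_divideR]) auto
    also have "(\<lambda>y. y /\<^sub>R c) -` (space (lebesgue_on X) - Z) \<inter> space ?N = {y \<in> space ?N. y /\<^sub>R c \<notin> Z}"
      using c by auto
    finally show "{y \<in> space ?N. y /\<^sub>R c \<notin> Z} \<in> sets ?N" .
  qed
  then have "AE y in ?N. y /\<^sub>R c \<notin> Z"
    using c unfolding distr_lebesgue_on_scaleR[OF X c] by (subst (asm) AE_density) auto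
  moreover have "AE y in ?N. y \<in> (\<lambda>x. c *\<^sub>R x) ` X"
    by (rule AE_I2) simp
  ultimately show ?thesis
  proof eventually_elim
    case (elim y)
    then show ?case using Z(2) c by auto
  qed
qed

lemma U_class_0_divideR:
  fixes X :: "'a::euclidean_space set"
  assumes "X \<in> sets lebesgue" "0 < c" "D \<in> U_class 0 X"
  shows "(\<lambda>y. D (y /\<^sub>R c)) \<in> U_class 0 ((\<lambda>x. c *\<^sub>R x) ` X)"
proof -
  from assms(3) obtain \<epsilon> where D: "D \<in> borel_measurable (lebesgue_on X)" and "0 < \<epsilon>"
    and ae: "AE x in lebesgue_on X. \<epsilon> \<le> D x \<and> D x \<le> 1 - \<epsilon>"
    by (auto simp: U_class_0_iff)
  moreover have "(\<lambda>y. D (y /\<^sub>R c)) \<in> borel_measurable (lebesgue_on ((\<lambda>x. c *\<^sub>R x) ` X))"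
    using measurable_compose[OF measurable_lebesgue_on_divideR D] assms(2) by simp
  ultimately show ?thesis
    using AE_lebesgue_on_divideR[OF assms(1,2) ae] by (auto simp: U_class_0_iff)
qed

text \<open>Each term of the objective is built from integrals against push-forward laws, so the
  change of variables removes \<open>c\<close>. Hence all times contribute equally once the
  discriminator is rescaled too.\<close>

lemma F_obj_scaled_density:
  fixes X :: "(real ^ 'n) set"
  assumes X: "X \<in> sets lebesgue" and c: "0 < c"
    and p: "p \<in> borel_measurable (lebesgue_on X)" and q: "q \<in> borel_measurable (lebesgue_on X)"
    and D: "D \<in> borel_measurable (lebesgue_on X)"
  shows "F_obj ((\<lambda>x. c *\<^sub>R x) ` X) (scaled_density c p) (scaled_density c q) (\<lambda>y. D (y /\<^sub>R c)) lam
       = F_obj X p q D lam"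
proof -
  let ?N = "lebesgue_on ((\<lambda>x. c *\<^sub>R x) ` X)"
  have [measurable]: "(\<lambda>y. D (y /\<^sub>R c)) \<in> borel_measurable ?N"
    using measurable_compose[OF measurable_lebesgue_on_divideR D] c by simp
  have T: "(*\<^sub>R) c \<in> density_on X r \<rightarrow>\<^sub>M ?N" for r
    using measurable_lebesgue_on_scaleR[of c X] by (simp add: density_on_def)
  have int: "(\<integral>y. g y \<partial>density_on ((\<lambda>x. c *\<^sub>R x) ` X) (scaled_density c r))
      = (\<integral>x. g (c *\<^sub>R x) \<partial>density_on X r)"
    if "g \<in> borel_measurable ?N" "r \<in> borel_measurable (lebesgue_on X)"
    for g :: "real ^ 'n \<Rightarrow> real" and r
    unfolding density_on_scaled_density[OF X c that(2)] by (rule integral_distr[OF T that(1)])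
  show ?thesis
    using c p q by (simp add: F_obj_def int)
qed

section \<open>Probability measures from densities, and elementary bounds on expectations\<close>

lemma prob_space_density_on:
  assumes "r \<in> borel_measurable (lebesgue_on S)" "integrable (lebesgue_on S) r"
    "AE x in lebesgue_on S. 0 \<le> r x" "(LINT x|lebesgue_on S. r x) = 1"
  shows "prob_space (density_on S r)"
proof
  have "(\<integral>\<^sup>+x. ennreal (r x) \<partial>lebesgue_on S) = 1"
    using assms by (simp add: nn_integral_eq_integral)
  then show "emeasure (density_on S r) (space (density_on S r)) = 1"
    using assms(1) by (simp add: density_on_def emeasure_density del: space_lebesgue_on
        cong: nn_integral_cong)
qed

lemma prob_space_density_on_prob_density:
  "prob_density_on S p \<Longrightarrow> prob_space (density_on S p)"
  by (intro prob_space_density_on) (auto simp: prob_density_on_def intro!: AE_I2 less_imp_le)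

lemma abs_ln_le:
  fixes u \<epsilon> :: real
  assumes "0 < \<epsilon>" "\<epsilon> \<le> u" "u \<le> 1 - \<epsilon>"
  shows "\<bar>ln u\<bar> \<le> - ln \<epsilon>"
proof -
  have "ln \<epsilon> \<le> ln u" "ln u \<le> 0" using assms by auto
  then show ?thesis by linarith
qed

text \<open>Pointwise \<open>D x * (1 - D x) \<le> 1 / 4\<close>. Both expectations use the same
  measure: this is a discriminator facing two identical distributions.\<close>

lemma (in prob_space) expectation_ln_ln_le:
  fixes D :: "'a \<Rightarrow> real"
  assumes [measurable]: "D \<in> borel_measurable M" and "0 < \<epsilon>"
    and ae: "AE x in M. \<epsilon> \<le> D x \<and> D x \<le> 1 - \<epsilon>"
  shows "expectation (\<lambda>x. ln (D x)) + expectation (\<lambda>x. ln (1 - D x)) \<le> - ln 4"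
proof -
  have i1: "integrable M (\<lambda>x. ln (D x))"
    using ae \<open>0 < \<epsilon>\<close> by (intro integrable_const_bound[where B = "- ln \<epsilon>"]) (auto intro: abs_ln_le)
  have i2: "integrable M (\<lambda>x. ln (1 - D x))"
    using ae \<open>0 < \<epsilon>\<close> by (intro integrable_const_bound[where B = "- ln \<epsilon>"]) (auto intro: abs_ln_le)
  have "expectation (\<lambda>x. ln (D x)) + expectation (\<lambda>x. ln (1 - D x))
      = expectation (\<lambda>x. ln (D x) + ln (1 - D x))"
    using i1 i2 by simp
  also have "\<dots> \<le> expectation (\<lambda>x. - ln 4)"
  proof (rule integral_mono_AE)
    show "AE x in M. ln (D x) + ln (1 - D x) \<le> - ln 4"
      using ae
    proof eventually_elim
      case (elim x)
      have "0 \<le> (2 * D x - 1)\<^sup>2" by simp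
      then have "D x * (1 - D x) \<le> 1 / 4"
        by (simp add: power2_eq_square algebra_simps)
      moreover have "0 < D x" "0 < 1 - D x" using elim \<open>0 < \<epsilon>\<close> by auto
      ultimately have "ln (D x * (1 - D x)) \<le> ln (1 / 4)"
        by (subst ln_le_cancel_iff) auto
      then show ?case
        using \<open>0 < D x\<close> \<open>0 < 1 - D x\<close> by (simp add: ln_mult ln_div)
    qed
  qed (use i1 i2 in auto)
  also have "\<dots> = - ln 4" by (simp add: prob_space)
  finally show ?thesis .
qed

text \<open>The mean square deviation from \<open>a\<close> is the variance plus
  \<open>(expectation D - a)\<^sup>2\<close>. It is applied with \<open>a = 1/2\<close>, the value
  of the optimal discriminator where both densities agree.\<close>

lemma (in prob_space) variance_le_expectation_square_diff:
  fixes D :: "'a \<Rightarrow> real"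
  assumes [measurable]: "D \<in> borel_measurable M" and ae: "AE x in M. \<bar>D x\<bar> \<le> B"
  shows "variance D \<le> expectation (\<lambda>x. (D x - a)\<^sup>2)"
proof -
  have i1: "integrable M D"
    using ae by (intro integrable_const_bound[where B = B]) auto
  have i2: "integrable M (\<lambda>x. (D x)\<^sup>2)"
  proof (rule integrable_const_bound[where B = "B\<^sup>2"])
    show "AE x in M. norm ((D x)\<^sup>2) \<le> B\<^sup>2"
      using ae by eventually_elim (simp add: abs_le_square_iff[symmetric])
  qed simp
  have "expectation (\<lambda>x. (D x - a)\<^sup>2) = expectation (\<lambda>x. (D x)\<^sup>2 - 2 * a * D x + a\<^sup>2)"
    by (intro Bochner_Integration.integral_cong) (auto simp: power2_eq_square algebra_simps)
  also have "\<dots> = expectation (\<lambda>x. (D x)\<^sup>2) - 2 * a * expectation D + a\<^sup>2"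
    using i1 i2 by (simp add: prob_space)
  also have "\<dots> = variance D + (expectation D - a)\<^sup>2"
    unfolding variance_eq[OF i1 i2] by (simp add: power2_eq_square algebra_simps)
  finally show ?thesis by simp
qed

section \<open>The entropy gap and rigidity for small \<open>lam\<close>\<close>

text \<open>The right-hand side is the Kullback-Leibler divergence of a Bernoulli law with parameter
  \<open>u\<close> from the fair coin. It is bounded below by a squared Hellinger distance,
  expressed through \<open>a = sqrt (2 * u)\<close> and
  \<open>b = sqrt (2 * (1 - u))\<close>.\<close>

lemma binary_entropy_gap_ge:
  fixes u :: real
  assumes "0 < u" "u < 1"
  shows "(2/9) * (u - 1/2)\<^sup>2 \<le> u * ln u + (1 - u) * ln (1 - u) + ln 2"
proof -
  define a b where "a = sqrt (2 * u)" and "b = sqrt (2 * (1 - u))"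
  have a: "0 < a" "a\<^sup>2 = 2 * u" and b: "0 < b" "b\<^sup>2 = 2 * (1 - u)"
    using assms by (auto simp: a_def b_def)
  \<comment> \<open>This is \<open>1 - 1 / c \<le> ln c\<close> multiplied by
    \<open>c\<^sup>2 = 2 * v\<close>.\<close>
  have *: "c\<^sup>2 - c \<le> v * ln (2 * v)" if "0 < c" "c\<^sup>2 = 2 * v" for c v :: real
  proof -
    have "1 - 1 / c \<le> ln c"
      using ln_le_minus_one[of "1 / c"] that by (simp add: ln_div)
    then have "c\<^sup>2 * (1 - 1 / c) \<le> c\<^sup>2 * ln c"
      by (intro mult_left_mono) auto
    also have "c\<^sup>2 * ln c = v * ln (c\<^sup>2)"
      using that(2) ln_realpow[of c 2] that(1) by simp
    finally show ?thesis
      using that by (simp add: power2_eq_square right_diff_distrib)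
  qed
  \<comment> \<open>The crude bound \<open>a \<le> 2\<close> gives
    \<open>(a + 1)\<^sup>2 \<le> 9\<close>, and 9 is the source of the constant
    \<open>2/9\<close>.\<close>
  have "a \<le> 2"
    using a assms by (intro power2_le_imp_le[of a 2]) auto
  then have "(a + 1)\<^sup>2 \<le> 3\<^sup>2"
    using a(1) by (intro power_mono) auto
  have "(u - 1/2)\<^sup>2 = (a - 1)\<^sup>2 * (a + 1)\<^sup>2 / 4"
  proof -
    have "u - 1/2 = (a - 1) * (a + 1) / 2"
      using a(2) by (simp add: power2_eq_square algebra_simps)
    then have "(u - 1/2)\<^sup>2 = ((a - 1) * (a + 1) / 2)\<^sup>2" by (rule arg_cong)
    then show ?thesis by (simp add: power_mult_distrib power_divide)
  qed
  also have "\<dots> \<le> (a - 1)\<^sup>2 * 9 / 4"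
    using \<open>(a + 1)\<^sup>2 \<le> 3\<^sup>2\<close> by (intro divide_right_mono mult_left_mono) auto
  finally have "(2/9) * (u - 1/2)\<^sup>2 \<le> ((a - 1)\<^sup>2 + (b - 1)\<^sup>2) / 2"
    by (auto intro: add_increasing2 order_trans)
  \<comment> \<open>Uses \<open>a\<^sup>2 + b\<^sup>2 = 2\<close>; both sides equal
    \<open>2 - a - b\<close>.\<close>
  also have "\<dots> = (a\<^sup>2 - a) + (b\<^sup>2 - b)"
    using a(2) b(2) by (simp add: power2_eq_square field_simps)
  also have "\<dots> \<le> u * ln (2 * u) + (1 - u) * ln (2 * (1 - u))"
    by (intro add_mono * a b)
  also have "\<dots> = u * ln u + (1 - u) * ln (1 - u) + ln 2"
    using assms ln_mult[of 2 u] ln_mult[of 2 "1 - u"]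
    by (simp add: ring_distribs(1) del: ln_mult) (simp add: algebra_simps)
  finally show ?thesis .
qed

text \<open>With \<open>?I\<close> the integral of \<open>p x * (D x - 1/2)\<^sup>2\<close>, the
  entropy gap gives \<open>(2/9) * ?I\<close> as a lower bound for the unpenalised objective plus
  \<open>ln 4\<close>, which the hypothesis bounds above by \<open>lam\<close> times the variance,
  hence by \<open>lam * ?I\<close>. So \<open>?I\<close> vanishes and \<open>D\<close> is
  \<open>1/2\<close> almost everywhere.\<close>

lemma AE_eq_if_F_obj_le:
  fixes p q :: "'a::euclidean_space \<Rightarrow> real"
  assumes p: "prob_density_on S p" and q: "integrable (lebesgue_on S) q" "(LINT x|lebesgue_on S. q x) = 1"
    and U: "(\<lambda>x. p x / (p x + q x)) \<in> U_class 0 S"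
    and lam: "0 < lam" "lam < 2/9"
    and le: "F_obj S p q (\<lambda>x. p x / (p x + q x)) lam \<le> - ln 4"
  shows "AE x in lebesgue_on S. q x = p x"
proof -
  let ?M = "lebesgue_on S"
  define D where "D = (\<lambda>x. p x / (p x + q x))"
  have ip: "integrable ?M p" and p1: "(LINT x|?M. p x) = 1" and p0: "AE x in ?M. 0 < p x"
    using p by (auto simp: prob_density_on_def intro!: AE_I2)
  have [measurable]: "p \<in> borel_measurable ?M" "q \<in> borel_measurable ?M"
    using ip q(1) by auto
  from U obtain \<epsilon> where [measurable]: "D \<in> borel_measurable ?M" and "0 < \<epsilon>"
    and D: "AE x in ?M. \<epsilon> \<le> D x \<and> D x \<le> 1 - \<epsilon>"
    by (auto simp: U_class_0_iff D_def)
  \<comment> \<open>As \<open>p x > 0\<close>, a positive quotient forces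
    \<open>p x + q x > 0\<close>, and a quotient below 1 then forces \<open>q x > 0\<close>.\<close>
  have q0: "AE x in ?M. 0 < q x"
    using p0 D
  proof eventually_elim
    case (elim x)
    then have "0 < p x / (p x + q x)" "p x / (p x + q x) < 1"
      using \<open>0 < \<epsilon>\<close> by (auto simp: D_def)
    then have "0 < p x + q x" using elim(1) by (simp add: zero_less_divide_iff)
    then show ?case using \<open>p x / (p x + q x) < 1\<close> by simp
  qed
  \<comment> \<open>Positivity of \<open>r\<close> matters because \<open>ennreal\<close> cuts
    negative values of a density off to 0.\<close>
  have dens: "(\<integral>x. f x \<partial>density_on S r) = (\<integral>x. r x * f x \<partial>?M)"
    if "f \<in> borel_measurable ?M" "r \<in> borel_measurable ?M" "AE x in ?M. 0 < r x" for f r :: "'a \<Rightarrow> real"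
    unfolding density_on_def using that
    by (subst integral_density) (auto elim: eventually_mono)
  have bdd: "integrable ?M (\<lambda>x. r x * f x)"
    if "integrable ?M r" "f \<in> borel_measurable ?M" "AE x in ?M. \<bar>f x\<bar> \<le> B" for r f :: "'a \<Rightarrow> real" and B
  proof (rule Bochner_Integration.integrable_bound)
    show "integrable ?M (\<lambda>x. B * r x)" using that(1) by simp
    show "(\<lambda>x. r x * f x) \<in> borel_measurable ?M" using that by auto
    show "AE x in ?M. norm (r x * f x) \<le> norm (B * r x)"
      using that(3)
    proof eventually_elim
      case (elim x)
      then have "\<bar>f x\<bar> \<le> \<bar>B\<bar>" by linarith
      then show ?case by (auto simp: abs_mult mult.commute intro: mult_right_mono)
    qed
  qed
  have i1: "integrable ?M (\<lambda>x. p x * ln (D x))"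
    using D \<open>0 < \<epsilon>\<close> by (intro bdd[OF ip, of _ "- ln \<epsilon>"]) (auto intro: abs_ln_le)
  have i2: "integrable ?M (\<lambda>x. q x * ln (1 - D x))"
    using D \<open>0 < \<epsilon>\<close> by (intro bdd[OF q(1), of _ "- ln \<epsilon>"]) (auto intro: abs_ln_le)
  have i3: "integrable ?M (\<lambda>x. p x * (D x - 1/2)\<^sup>2)"
  proof (rule bdd[OF ip, of _ 1])
    show "AE x in ?M. \<bar>(D x - 1/2)\<^sup>2\<bar> \<le> 1"
      using D
    proof eventually_elim
      case (elim x)
      then show ?case using \<open>0 < \<epsilon>\<close> by (auto simp: abs_square_le_1)
    qed
  qed simp
  let ?I = "\<integral>x. p x * (D x - 1/2)\<^sup>2 \<partial>?M"
  interpret P: prob_space "density_on S p"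
    by (rule prob_space_density_on_prob_density[OF p])
  have var: "P.variance D \<le> ?I"
  proof -
    have "AE x in density_on S p. \<bar>D x\<bar> \<le> 1"
    proof (unfold density_on_def, subst AE_density)
      show "AE x in ?M. 0 < ennreal (p x) \<longrightarrow> \<bar>D x\<bar> \<le> 1"
        using D by eventually_elim (use \<open>0 < \<epsilon>\<close> in auto)
    qed simp
    then have "P.variance D \<le> P.expectation (\<lambda>x. (D x - 1/2)\<^sup>2)"
      by (intro P.variance_le_expectation_square_diff) (auto simp: density_on_def)
    also have "\<dots> = ?I" using p0 by (intro dens) auto
    finally show ?thesis .
  qed
  have "(2/9) * ?I \<le> (\<integral>x. p x * ln (D x) + q x * ln (1 - D x) + ln 2 * (p x + q x) \<partial>?M)"
    unfolding integral_mult_right_zero[symmetric]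
  proof (rule integral_mono_AE)
    show "AE x in ?M. 2/9 * (p x * (D x - 1/2)\<^sup>2)
        \<le> p x * ln (D x) + q x * ln (1 - D x) + ln 2 * (p x + q x)"
      using p0 q0
    proof eventually_elim
      case (elim x)
      let ?w = "p x + q x"
      \<comment> \<open>The integrand is thus the total weight \<open>?w\<close> times the entropy
        gap at \<open>D x\<close>.\<close>
      have w: "p x = ?w * D x" "q x = ?w * (1 - D x)"
        using elim by (auto simp: D_def field_simps)
      have "0 < D x" "D x < 1" using elim by (auto simp: D_def)
      from binary_entropy_gap_ge[OF this]
      have "?w * ((2/9) * (D x - 1/2)\<^sup>2) \<le> ?w * (D x * ln (D x) + (1 - D x) * ln (1 - D x) + ln 2)"
        using elim by (intro mult_left_mono) auto
      also have "\<dots> = ?w * D x * ln (D x) + ?w * (1 - D x) * ln (1 - D x) + ln 2 * ?w"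
        by (simp add: algebra_simps)
      also have "\<dots> = p x * ln (D x) + q x * ln (1 - D x) + ln 2 * ?w"
        by (simp only: w[symmetric])
      finally have "?w * ((2/9) * (D x - 1/2)\<^sup>2) \<le> p x * ln (D x) + q x * ln (1 - D x) + ln 2 * ?w" .
      \<comment> \<open>Lowering the weight from \<open>?w\<close> to \<open>p x\<close> yields the
        integral that also bounds the variance under \<open>p\<close>.\<close>
      moreover have "p x * ((2/9) * (D x - 1/2)\<^sup>2) \<le> ?w * ((2/9) * (D x - 1/2)\<^sup>2)"
        using elim by (intro mult_right_mono) auto
      ultimately show ?case by (simp add: mult.left_commute)
    qed
  qed (use i1 i2 i3 ip q(1) in auto)
  \<comment> \<open>Both densities integrate to 1, so the last summand contributes
    \<open>2 * ln 2 = ln 4\<close>.\<close>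
  also have "\<dots> = (\<integral>x. p x * ln (D x) \<partial>?M) + (\<integral>x. q x * ln (1 - D x) \<partial>?M) + ln 4"
    using i1 i2 ip q p1 ln_realpow[of 2 2] by simp
  also have "\<dots> = F_obj S p q D lam + lam * P.variance D + ln 4"
    using p0 q0 by (simp add: F_obj_def dens)
  also have "\<dots> \<le> lam * ?I"
    using le[folded D_def] mult_left_mono[OF var, of lam] lam(1) by linarith
  finally have "(2/9 - lam) * ?I \<le> 0"
    by (simp add: algebra_simps)
  then have "?I \<le> 0"
    using lam(2) by (simp add: mult_le_0_iff)
  moreover have nn: "AE x in ?M. 0 \<le> p x * (D x - 1/2)\<^sup>2"
    using p0 by eventually_elim simp
  ultimately have "?I = 0"
    using integral_nonneg_AE[OF nn] by linarith
  then have "AE x in ?M. p x * (D x - 1/2)\<^sup>2 = 0"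
    using integral_nonneg_eq_0_iff_AE[OF i3 nn] by simp
  then show ?thesis
    using p0 q0
  proof eventually_elim
    case (elim x)
    then have "D x = 1/2" by simp
    then show ?case using elim by (simp add: D_def field_simps)
  qed
qed

section \<open>The expectation over time and the maximal value\<close>

lemma ext_expectation_const:
  assumes "prob_space M" "\<And>x. x \<in> space M \<Longrightarrow> f x = v"
  shows "ext_expectation M f = ereal v"
proof -
  have "(\<integral>\<^sup>+ x. ennreal (f x) \<partial>M) = ennreal v" "(\<integral>\<^sup>+ x. ennreal (- f x) \<partial>M) = ennreal (- v)"
    using assms by (auto simp: prob_space.emeasure_space_1 cong: nn_integral_cong)
  then show ?thesis
    by (cases "0 \<le> v") (auto simp: ext_expectation_def ennreal_neg enn2ereal_ennreal zero_ennreal.rep_eq)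
qed

text \<open>As \<open>v \<le> 0\<close>, the positive part of \<open>f\<close> vanishes and the
  negative part is at least \<open>- v\<close>. This includes the case where the expectation is
  -\<infinity>.\<close>

lemma ext_expectation_le_const:
  assumes "prob_space M" "\<And>x. x \<in> space M \<Longrightarrow> f x \<le> v" "v \<le> 0"
  shows "ext_expectation M f \<le> ereal v"
proof -
  have "(\<integral>\<^sup>+ x. ennreal (f x) \<partial>M) = (\<integral>\<^sup>+ x. 0 \<partial>M)"
    using assms(2,3) by (intro nn_integral_cong) (force intro: ennreal_neg)
  moreover have "ennreal (- v) \<le> (\<integral>\<^sup>+ x. ennreal (- f x) \<partial>M)"
  proof -
    have "ennreal (- v) = (\<integral>\<^sup>+ x. ennreal (- v) \<partial>M)"
      using assms(1) by (simp add: prob_space.emeasure_space_1)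
    also have "\<dots> \<le> (\<integral>\<^sup>+ x. ennreal (- f x) \<partial>M)"
      using assms(2) by (intro nn_integral_mono) (auto intro!: ennreal_leI)
    finally show ?thesis .
  qed
  then have "ereal (- v) \<le> enn2ereal (\<integral>\<^sup>+ x. ennreal (- f x) \<partial>M)"
    using assms(3) by (simp add: less_eq_ennreal.rep_eq enn2ereal_ennreal)
  ultimately show ?thesis
    by (simp add: ext_expectation_def zero_ennreal.rep_eq ereal_uminus_le_reorder)
qed

text \<open>At \<open>q = p0\<close> both expectations are taken under one probability measure, so
  \<open>expectation_ln_ln_le\<close> applies at each time, and the variance penalty can only lower
  the value.\<close>

lemma max_value_same_le:
  fixes X :: "(real ^ 'n) set"
  assumes X: "X \<in> sets lebesgue" and p: "prob_density_on X p0" and \<pi>: "prob_density_on {0..T} \<pi>"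
    and s: "\<forall>t\<in>{0..T}. 0 < s t \<and> s t \<le> 1" and lam: "0 \<le> lam"
  shows "max_value X p0 T \<pi> s lam p0 \<le> ereal (- ln 4)"
  unfolding max_value_def
proof (rule SUP_least, rule ext_expectation_le_const)
  show "prob_space (density_on {0..T} \<pi>)"
    by (rule prob_space_density_on_prob_density[OF \<pi>])
  fix D t assume D: "D \<in> discriminator_families X p0 T s p0 lam"
    and "t \<in> space (density_on {0..T} \<pi>)"
  then have t: "t \<in> {0..T}" by (simp add: density_on_def)
  let ?S = "(\<lambda>x. s t *\<^sub>R x) ` X" and ?p = "scaled_density (s t) p0"
  have st: "0 < s t" using s t by auto
  have pm: "p0 \<in> borel_measurable (lebesgue_on X)"
    using p by (auto simp: prob_density_on_def)
  have eq: "density_on ?S ?p = distr (density_on X p0) (lebesgue_on ?S) ((*\<^sub>R) (s t))"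
    by (rule density_on_scaled_density[OF X st pm])
  have "(*\<^sub>R) (s t) \<in> density_on X p0 \<rightarrow>\<^sub>M lebesgue_on ?S"
    using measurable_lebesgue_on_scaleR[of "s t" X] by (simp add: density_on_def)
  then have "prob_space (density_on ?S ?p)"
    unfolding eq by (intro prob_space.prob_space_distr prob_space_density_on_prob_density p)
  then interpret N: prob_space "density_on ?S ?p" .
  from D t obtain \<epsilon> where Dm: "D t \<in> borel_measurable (lebesgue_on ?S)" and "0 < \<epsilon>"
    and ae: "AE x in lebesgue_on ?S. \<epsilon> \<le> D t x \<and> D t x \<le> 1 - \<epsilon>"
    unfolding discriminator_families_def U_class_0_iff by blast
  have "?p \<in> borel_measurable (lebesgue_on ?S)"
    using measurable_compose[OF measurable_lebesgue_on_divideR pm] st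
    unfolding scaled_density_def[abs_def] by (intro borel_measurable_divide) auto
  then have "AE x in density_on ?S ?p. \<epsilon> \<le> D t x \<and> D t x \<le> 1 - \<epsilon>"
    using ae unfolding density_on_def by (subst AE_density) (auto elim: eventually_mono)
  moreover have "D t \<in> borel_measurable (density_on ?S ?p)"
    using Dm by (simp add: density_on_def)
  ultimately have "N.expectation (\<lambda>x. ln (D t x)) + N.expectation (\<lambda>x. ln (1 - D t x)) \<le> - ln 4"
    using \<open>0 < \<epsilon>\<close> by (intro N.expectation_ln_ln_le)
  moreover have "0 \<le> lam * N.variance (D t)"
    using lam by (simp add: N.variance_positive)
  ultimately show "F_at X p0 s p0 D lam t \<le> - ln 4"
    by (simp add: F_at_def F_obj_def)
qed simp

text \<open>A single discriminator on \<open>X\<close> is transported to every time by rescaling.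
  The objective is then constant in \<open>t\<close>, which settles the measurability clause and
  makes the expectation over time equal to that constant.\<close>

lemma F_obj_le_max_value:
  fixes X :: "(real ^ 'n) set"
  assumes X: "X \<in> sets lebesgue" and \<pi>: "prob_density_on {0..T} \<pi>"
    and s: "\<forall>t\<in>{0..T}. 0 < s t \<and> s t \<le> 1"
    and p: "p0 \<in> borel_measurable (lebesgue_on X)" and q: "q \<in> borel_measurable (lebesgue_on X)"
    and D: "D \<in> U_class 0 X"
  shows "ereal (F_obj X p0 q D lam) \<le> max_value X p0 T \<pi> s lam q"
proof -
  define E where "E = (\<lambda>t y. D (y /\<^sub>R s t))"
  have const: "F_at X p0 s q E lam t = F_obj X p0 q D lam" if "t \<in> {0..T}" for t
    unfolding F_at_def E_def using s that D X p q
    by (intro F_obj_scaled_density) (auto simp: U_class_0_iff)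
  have "F_at X p0 s q E lam \<in> borel_measurable (lebesgue_on {0..T})"
    using const by (subst measurable_cong[where g = "\<lambda>_. F_obj X p0 q D lam"]) auto
  then have "E \<in> discriminator_families X p0 T s q lam"
    using U_class_0_divideR[OF X _ D] s by (auto simp: discriminator_families_def E_def)
  moreover have "ext_expectation (density_on {0..T} \<pi>) (F_at X p0 s q E lam) = ereal (F_obj X p0 q D lam)"
    using const by (intro ext_expectation_const prob_space_density_on_prob_density \<pi>)
      (auto simp: density_on_def)
  ultimately show ?thesis
    unfolding max_value_def by (metis SUP_upper)
qed

section \<open>Feasibility of the true density and the conclusion\<close>

text \<open>Here the quotient is the constant \<open>1/2\<close>, strictly between \<delta> and
  \<open>1 - \<delta>\<close>. Feasibility lets the optimal solution be compared with
  \<open>p0\<close>.\<close>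

lemma prob_density_in_Q_class:
  assumes p: "prob_density_on X p0" and "Linf_norm_on X p0 < \<infinity>" "Lip_norm_on X p0 \<le> ennreal C"
    and \<delta>: "0 \<le> \<delta>" "\<delta> < 1 / 2"
  shows "p0 \<in> Q_class X p0 \<delta> C"
proof -
  have pm[measurable]: "p0 \<in> borel_measurable (lebesgue_on X)"
    using p by (auto simp: prob_density_on_def)
  have half: "p0 x / (p0 x + p0 x) = 1 / 2" if "x \<in> X" for x
    using p that by (force simp: prob_density_on_def field_simps)
  \<comment> \<open>\<open>esssup_const\<close> is applied on a space of nonzero measure;
    \<open>X\<close> is not null because \<open>p0\<close> has integral 1.\<close>
  have ne: "emeasure (lebesgue_on X) (space (lebesgue_on X)) \<noteq> 0"
  proof
    assume "emeasure (lebesgue_on X) (space (lebesgue_on X)) = 0"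
    then have "AE x in lebesgue_on X. p0 x = 0"
      by (intro AE_I[of _ _ "space (lebesgue_on X)"]) auto
    then have "(LINT x|lebesgue_on X. p0 x) = (LINT x|lebesgue_on X. 0)"
      by (intro integral_cong_AE) auto
    then show False using p by (simp add: prob_density_on_def)
  qed
  \<comment> \<open>A general \<open>g\<close> treats the upper bound, the lower bound and the sup
    norm at once.\<close>
  have *: "esssup (lebesgue_on X) (\<lambda>x. g (p0 x / (p0 x + p0 x))) = g (1 / 2)"
    if [measurable]: "g \<in> borel_measurable borel" for g :: "real \<Rightarrow> ereal"
  proof -
    have "esssup (lebesgue_on X) (\<lambda>x. g (p0 x / (p0 x + p0 x))) = esssup (lebesgue_on X) (\<lambda>x. g (1 / 2))"
      by (intro esssup_AE_cong AE_I2; (simp only: half space_lebesgue_on)?) measurable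
    then show ?thesis using esssup_const[OF ne] by simp
  qed
  have "(\<lambda>x. p0 x / (p0 x + p0 x)) \<in> U_class \<delta> X"
    using *[of ereal] *[of "\<lambda>x. - ereal x"] *[of "\<lambda>x. ereal \<bar>x\<bar>"] \<delta>
    by (simp add: U_class_def Linf_on_def Linf_norm_on_def ess_inf_on_def ess_sup_on_def)
  then show ?thesis
    using assms pm by (auto simp: Q_class_def prob_density_on_def Linf_on_def)
qed

theorem theoremD6:
  fixes X :: "(real ^ 'n) set" and p0 :: "real ^ 'n \<Rightarrow> real" and C \<delta> :: real
  assumes "X = {x. \<forall>i. 0 \<le> x $ i \<and> x $ i \<le> 1} \<or> X = UNIV"
    and "prob_density_on X p0"
    and "0 < C"
    and "Linf_norm_on X p0 < \<infinity>"
    and "Lip_norm_on X p0 < ennreal C"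
    and "0 \<le> \<delta>" and "\<delta> < 1 / 2"
  shows "\<exists>K::real. \<forall>\<^sub>F lam in at_right 0.
           \<forall>(T::real) (\<pi>::real \<Rightarrow> real) (s::real \<Rightarrow> real) (q::real ^ 'n \<Rightarrow> real).
             prob_density_on {0..T} \<pi> \<longrightarrow>
             (\<forall>t\<in>{0..T}. 0 < s t \<and> s t \<le> 1) \<longrightarrow>
             s 0 = 1 \<longrightarrow>
             optimal_solution X p0 \<delta> C T \<pi> s lam q \<longrightarrow>
             Linf_norm_on X (\<lambda>x. q x - p0 x) \<le> ereal (K * lam powr (1 / (real CARD('n) + 3)))"
proof (intro exI[of _ 0] eventually_at_rightI[of 0 "2/9"] allI impI)
  \<comment> \<open>The threshold \<open>2/9\<close> is the constant of
    \<open>binary_entropy_gap_ge\<close>. Below it \<open>q\<close> agrees with \<open>p0\<close>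
    almost everywhere, so the witness \<open>K = 0\<close> suffices.\<close>
  fix lam T :: real and \<pi> s :: "real \<Rightarrow> real" and q :: "real ^ 'n \<Rightarrow> real"
  assume lam: "lam \<in> {0<..<2/9}" and \<pi>: "prob_density_on {0..T} \<pi>"
    and s: "\<forall>t\<in>{0..T}. 0 < s t \<and> s t \<le> 1" and opt: "optimal_solution X p0 \<delta> C T \<pi> s lam q"
  have "{x :: real ^ 'n. \<forall>i. 0 \<le> x $ i \<and> x $ i \<le> 1} = cbox 0 1"
    by (auto simp: mem_box_cart)
  then have X: "X \<in> sets lebesgue"
    using assms(1) by auto
  have pm: "p0 \<in> borel_measurable (lebesgue_on X)"
    using assms(2) by (auto simp: prob_density_on_def)
  have "p0 \<in> Q_class X p0 \<delta> C"
    using assms by (intro prob_density_in_Q_class) auto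
  then have qQ: "q \<in> Q_class X p0 \<delta> C"
    and le: "max_value X p0 T \<pi> s lam q \<le> max_value X p0 T \<pi> s lam p0"
    using opt by (auto simp: optimal_solution_def is_arg_min_def not_less)
  then have q: "integrable (lebesgue_on X) q" "(LINT x|lebesgue_on X. q x) = 1"
    and U: "(\<lambda>x. p0 x / (p0 x + q x)) \<in> U_class 0 X"
    using U_class_mono[OF assms(6)] by (auto simp: Q_class_def)
  \<comment> \<open>The discriminator \<open>p0 x / (p0 x + q x)\<close> bounds the value at
    \<open>q\<close> from below; optimality and the bound at \<open>p0\<close> close the chain at
    \<open>- ln 4\<close>.\<close>
  have "ereal (F_obj X p0 q (\<lambda>x. p0 x / (p0 x + q x)) lam) \<le> max_value X p0 T \<pi> s lam q"
    using q by (intro F_obj_le_max_value X \<pi> s pm U) auto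
  also note le
  also have "max_value X p0 T \<pi> s lam p0 \<le> ereal (- ln 4)"
    using lam by (intro max_value_same_le X assms(2) \<pi> s) auto
  finally have "AE x in lebesgue_on X. q x = p0 x"
    using lam by (intro AE_eq_if_F_obj_le assms(2) q U) auto
  then have "Linf_norm_on X (\<lambda>x. q x - p0 x) \<le> 0"
    unfolding Linf_norm_on_def using pm q(1)
    by (intro esssup_I) (auto elim!: AE_mp intro!: AE_I2)
  then show "Linf_norm_on X (\<lambda>x. q x - p0 x) \<le> ereal (0 * lam powr (1 / (real CARD('n) + 3)))"
    by (simp add: zero_ereal_def)
qed simp

end
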